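(* Let $q=4$ or $q=6$, set $\widetilde{q}:=(q-2)/q$, let $x$ be a variable (or a complex number), and for $k\ge 0$ let $$b_k^{(1)}:=\frac{1}{k+1}B_{k+1,\chi_{2q,1}}(x),\qquad b_k^{(2)}:=\frac{1}{k+1}B_{k+1,\chi_{2q,2}}(x),$$ where the characters $\chi_{2q,1},\chi_{2q,2}$ modulo $2q$ are those specified in the context. Then for all integers $m\geq 0$ we have $H_{2m}\big(b_k^{(1)}\big)=0$, and $$H_{2m+1}\big(b_k^{(1)}\big)=(-1)^{m+1}\left(\frac{q-2}{2}q^{2m}\right)^{2m+2}\prod_{\ell=1}^m\left(\frac{\ell^2}{4}\left(\widetilde{q}^{\,2}-(2\ell)^2\right)\right)^{2(m+1-\ell)},$$ $$H_{2m}\big(b_k^{(2)}\big)=(-1)^{m+1}\frac{q^{2m(2m+1)}}{m!^2}\prod_{\ell=1}^m\left(\frac{\ell^2}{4}\left(\widetilde{q}^{\,2}-(2\ell-1)^2\right)\right)^{2(m+1-\ell)},$$ $$H_{2m+1}\big(b_k^{(2)}\big)=\left(\frac{1}{2}q^{2m+1}\right)^{2m+2}\prod_{\ell=0}^m\frac{\ell!^4}{16^\ell}\left(\widetilde{q}^{\,2}-(2\ell+1)^2\right)^{2(m-\ell)+1}.$$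
   Context: For a Dirichlet character $\chi$ modulo $N$, the generalized Bernoulli numbers and polynomials (taken with respect to the modulus $N$) are defined by $\sum_{a=1}^N\frac{\chi(a)te^{at}}{e^{Nt}-1}=\sum_{n\ge 0}B_{n,\chi}\frac{t^n}{n!}$ and $B_{n,\chi}(x)=\sum_{k=0}^n\binom{n}{k}B_{k,\chi}x^{n-k}$. The characters are: modulo 8, $\chi_{8,1}$ takes the values $1,-1,-1,1$ and $\chi_{8,2}$ the values $1,1,-1,-1$ at $1,3,5,7$ respectively; modulo 12, $\chi_{12,1}$ takes the values $1,-1,-1,1$ and $\chi_{12,2}$ the values $1,1,-1,-1$ at $1,5,7,11$ respectively; all are $0$ at residues not coprime to the modulus. The character $\chi_{12,2}$ is not primitive; it is regarded as a character modulo $12$, so $N=12$ is used in the definition above. For a sequence $(c_0,c_1,\ldots)$ (indexed from $k=0$), $H_n(c_k)=\det\big(c_{i+j}\big)_{0\le i,j\le n}$. Here $m!^2=(m!)^2$, $\ell!^4=(\ell!)^4$, and empty products equal $1$. *)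

theory Defs
  imports Complex_Main "HOL-Computational_Algebra.Formal_Power_Series"
    "Jordan_Normal_Form.Determinant"
begin

definition chi_8_1 :: "nat \<Rightarrow> complex" where
  "chi_8_1 a = (if a mod 8 \<in> {1, 7} then 1 else if a mod 8 \<in> {3, 5} then -1 else 0)"

definition chi_8_2 :: "nat \<Rightarrow> complex" where
  "chi_8_2 a = (if a mod 8 \<in> {1, 3} then 1 else if a mod 8 \<in> {5, 7} then -1 else 0)"

definition chi_12_1 :: "nat \<Rightarrow> complex" where
  "chi_12_1 a = (if a mod 12 \<in> {1, 11} then 1 else if a mod 12 \<in> {5, 7} then -1 else 0)"

definition chi_12_2 :: "nat \<Rightarrow> complex" where
  "chi_12_2 a = (if a mod 12 \<in> {1, 5} then 1 else if a mod 12 \<in> {7, 11} then -1 else 0)"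

(* The modulus N is a separate argument because B depends on it when the character
   is not primitive. For N > 0 the denominator has a simple zero at t = 0, which the
   factor t in the numerator cancels, so the division of power series is exact. *)
definition gen_bernoulli_egf :: "nat \<Rightarrow> (nat \<Rightarrow> complex) \<Rightarrow> complex fps" where
  "gen_bernoulli_egf N chi =
     (\<Sum>a = 1..N. (fps_const (chi a) * fps_X * fps_exp (of_nat a)) / (fps_exp (of_nat N) - 1))"

definition gen_bernoulli :: "nat \<Rightarrow> (nat \<Rightarrow> complex) \<Rightarrow> nat \<Rightarrow> complex" where
  "gen_bernoulli N chi n = fact n * fps_nth (gen_bernoulli_egf N chi) n"

definition gen_bernpoly :: "nat \<Rightarrow> (nat \<Rightarrow> complex) \<Rightarrow> nat \<Rightarrow> complex poly" where
  "gen_bernpoly N chi n =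
     (\<Sum>k = 0..n. monom (of_nat (n choose k) * gen_bernoulli N chi k) (n - k))"

definition hankel_det :: "nat \<Rightarrow> (nat \<Rightarrow> 'a :: comm_ring_1) \<Rightarrow> 'a" where
  "hankel_det n c = det (mat (n + 1) (n + 1) (\<lambda>(i, j). c (i + j)))"

end

theory Submission
  imports Defs
begin

text \<open>
  With \<open>E = exp t\<close>, the sequences \<open>b1\<close> and \<open>- b2\<close> have exponential generating functions
  \<open>exp (x t) G\<close> with \<open>G (E^q + 1) = E^(q-1) + \<epsilon> E\<close>, where \<open>\<epsilon> = -1\<close> and \<open>\<epsilon> = 1\<close>
  respectively; the factor \<open>exp (x t)\<close> does not change Hankel determinants. Let \<open>L\<close> be the linear functional on polynomials with
  \<open>L (z^k) = k! [t^k] G\<close>. The equation for \<open>G\<close> says that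
  \<open>L (r (z + q/2) + r (z - q/2)) = r (q/2 - 1) + \<epsilon> r (1 - q/2)\<close>.
  Put \<open>a = q - 1\<close>, \<open>b = 1\<close> and let \<open>\<phi>\<^sub>i\<close>, \<open>\<psi>\<^sub>j\<close> be the products of \<open>(a + k q)^2 - z^2\<close>
  for \<open>k < i\<close> and of \<open>(b + k q)^2 - z^2\<close> for \<open>k < j\<close>. As for continuous dual Hahn polynomials,
  \<open>L (w \<phi>\<^sub>i \<psi>\<^sub>j)\<close> for \<open>w = 1, z, z^2\<close> is \<open>(i + j)!\<close> times a function of \<open>i\<close> times
  a function of \<open>j\<close>: for \<open>j = 0\<close> because \<open>r\<close> can be chosen to vanish at \<open>\<plusminus> (q/2 - 1)\<close>, and then
  by induction because \<open>\<psi>\<^sub>j\<^sub>+\<^sub>1 / \<psi>\<^sub>j - \<phi>\<^sub>i\<^sub>+\<^sub>1 / \<phi>\<^sub>i\<close> is a constant. Since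
  \<open>L\<close> respects parity, a triangular change of basis to \<open>\<phi>\<^sub>i, z \<phi>\<^sub>i\<close> on one side and to
  \<open>\<psi>\<^sub>j, z \<psi>\<^sub>j\<close> on the other reduces the Hankel determinants to determinants built from
  the matrix \<open>(i + j)!\<close>, which Vandermonde's identity factors into triangular matrices.
\<close>

subsection \<open>Determinants built from factorials\<close>

lemma det_lower_factor:
  fixes U V :: "nat \<Rightarrow> nat \<Rightarrow> 'a :: idom"
  assumes A: "\<And>i j. i \<le> n \<Longrightarrow> j \<le> n \<Longrightarrow> A i j = (\<Sum>k\<le>n. U i k * V j k)"
    and U: "\<And>i k. i < k \<Longrightarrow> U i k = 0" and V: "\<And>i k. i < k \<Longrightarrow> V i k = 0"
  shows "det (mat (Suc n) (Suc n) (\<lambda>(i, j). A i j)) = (\<Prod>k\<le>n. U k k * V k k)"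
proof -
  let ?N = "Suc n"
  let ?U = "mat ?N ?N (\<lambda>(i, j). U i j)" and ?V = "mat ?N ?N (\<lambda>(i, j). V i j)"
  have "mat ?N ?N (\<lambda>(i, j). A i j) = ?U * transpose_mat ?V"
    by (rule eq_matI) (auto simp: A scalar_prod_def atMost_atLeast0 atLeastLessThanSuc_atLeastAtMost)
  then have "det (mat ?N ?N (\<lambda>(i, j). A i j)) = det ?U * det ?V"
    by (simp add: det_mult[of _ ?N] det_transpose[of _ ?N])
  moreover have "det ?U = (\<Prod>k\<le>n. U k k)"
    by (subst det_lower_triangular[of ?N])
      (auto simp: U prod_list_diag_prod atMost_atLeast0 atLeastLessThanSuc_atLeastAtMost)
  moreover have "det ?V = (\<Prod>k\<le>n. V k k)"
    by (subst det_lower_triangular[of ?N])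
      (auto simp: V prod_list_diag_prod atMost_atLeast0 atLeastLessThanSuc_atLeastAtMost)
  ultimately show ?thesis
    by (simp add: prod.distrib)
qed

text \<open>Vandermonde's identity, sum over k of C(i,k) C(j,k) = C(i+j,i), scaled by i! j!. This
  splits the matrix (i+j)! into a lower triangular matrix times an upper triangular one, as
  \<open>det_lower_factor\<close> requires.\<close>

lemma fact_add_eq_sum:
  "(fact (i + j) :: 'a :: field_char_0) =
     (\<Sum>k\<le>i. fact i * of_nat (i choose k) * (fact j * of_nat (j choose k)))"
proof -
  have "(\<Sum>k\<le>i. (i choose k) * (j choose k)) = (\<Sum>k\<le>i. (j choose k) * (i choose (i - k)))"
    by (intro sum.cong) (auto simp: binomial_symmetric[symmetric])
  also have "\<dots> = (i + j) choose i"
    by (simp add: vandermonde add.commute)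
  finally have "(\<Sum>k\<le>i. (i choose k) * (j choose k)) = (i + j) choose i" .
  then have "(of_nat (fact (i + j)) :: 'a) =
      of_nat (fact i * fact j * (\<Sum>k\<le>i. (i choose k) * (j choose k)))"
    using binomial_fact_lemma[of i "i + j"] by simp
  then show ?thesis
    by (simp add: sum_distrib_left mult_ac)
qed

text \<open>The matrix interleaves two blocks of the form f g (i+j)!, one per parity. No reordering
  by parity is needed: the triangular factors \<open>W\<close> are interleaved in the same way and
  remain lower triangular.\<close>

lemma det_checkerboard_fact:
  fixes f g :: "nat \<Rightarrow> 'a :: field_char_0"
  assumes A: "\<And>I J. I \<le> n \<Longrightarrow> J \<le> n \<Longrightarrow>
      A I J = (if I mod 2 = J mod 2 then f I * g J * fact (I div 2 + J div 2) else 0)"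
  shows "det (mat (Suc n) (Suc n) (\<lambda>(i, j). A i j)) = (\<Prod>I\<le>n. f I * g I * fact (I div 2) ^ 2)"
proof -
  define W :: "(nat \<Rightarrow> 'a) \<Rightarrow> nat \<Rightarrow> nat \<Rightarrow> 'a" where
    "W f I K = (if I mod 2 = K mod 2 then f I * fact (I div 2) * of_nat ((I div 2) choose (K div 2)) else 0)"
    for f I K
  have lower: "W f I K = 0" if "I < K" for f I K
  proof (cases "I mod 2 = K mod 2")
    case True
    with that have "I div 2 < K div 2" by presburger
    then show ?thesis by (simp add: W_def)
  qed (simp add: W_def)
  have "A I J = (\<Sum>K\<le>n. W f I K * W g J K)" if "I \<le> n" "J \<le> n" for I J
  proof (cases "I mod 2 = J mod 2")
    case True
    \<comment> \<open>Only K of the parity of I with K div 2 at most I div 2 contribute; writing K =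
      2k + I mod 2 turns the sum into the one for (i+j)!.\<close>
    have "(\<Sum>K\<le>n. W f I K * W g J K) = (\<Sum>K \<in> (\<lambda>k. 2 * k + I mod 2) ` {..I div 2}. W f I K * W g J K)"
    proof (rule sum.mono_neutral_right)
      show "(\<lambda>k. 2 * k + I mod 2) ` {..I div 2} \<subseteq> {..n}"
        using \<open>I \<le> n\<close> by auto presburger
      show "\<forall>K\<in>{..n} - (\<lambda>k. 2 * k + I mod 2) ` {..I div 2}. W f I K * W g J K = 0"
      proof
        fix K assume K: "K \<in> {..n} - (\<lambda>k. 2 * k + I mod 2) ` {..I div 2}"
        have "I < K \<or> I mod 2 \<noteq> K mod 2"
        proof (rule ccontr)
          assume "\<not> (I < K \<or> I mod 2 \<noteq> K mod 2)"
          then have "K = 2 * (K div 2) + I mod 2" "K div 2 \<le> I div 2"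
            using mult_div_mod_eq[of 2 K] by (simp_all add: div_le_mono)
          then show False using K by blast
        qed
        then show "W f I K * W g J K = 0"
        proof
          assume "I < K"
          then show ?thesis by (simp add: lower)
        qed (simp add: W_def)
      qed
    qed simp
    also have "\<dots> = (\<Sum>k\<le>I div 2. W f I (2 * k + I mod 2) * W g J (2 * k + I mod 2))"
      by (subst sum.reindex) (auto simp: inj_on_def)
    also have "\<dots> = f I * g J * (\<Sum>k\<le>I div 2. fact (I div 2) * of_nat (I div 2 choose k) *
                              (fact (J div 2) * of_nat (J div 2 choose k)))"
      unfolding sum_distrib_left using True by (intro sum.cong) (auto simp: W_def)
    also have "\<dots> = A I J"
      using A[OF that] True by (simp flip: fact_add_eq_sum)
    finally show ?thesis ..
  next
    case False
    then have "(\<Sum>K\<le>n. W f I K * W g J K) = 0"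
      by (intro sum.neutral) (auto simp: W_def)
    then show ?thesis
      using A[OF that] False by simp
  qed
  from det_lower_factor[OF this lower lower]
  show ?thesis
    by (simp add: W_def power2_eq_square mult_ac)
qed

section \<open>Anti-checkerboard matrices, by exchanging neighbouring rows\<close>

primrec swap_pairs :: "nat \<Rightarrow> nat \<Rightarrow> nat" where
  "swap_pairs 0 = id"
| "swap_pairs (Suc m) = Transposition.transpose (2 * m) (2 * m + 1) \<circ> swap_pairs m"

lemma swap_pairs_permutes: "swap_pairs m permutes {..<2 * m}"
proof (induction m)
  case (Suc m)
  have "swap_pairs m permutes {..<2 * Suc m}"
    using Suc by (rule permutes_subset) auto
  then show ?case
    by (simp only: swap_pairs.simps) (intro permutes_compose permutes_swap_id; simp)
qed (auto simp: fun_eq_iff)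

lemma sign_swap_pairs: "sign (swap_pairs m) = (-1) ^ m"
proof (induction m)
  case (Suc m)
  have "permutation (swap_pairs m)"
    using swap_pairs_permutes permutation_permutes by blast
  then have "sign (swap_pairs (Suc m)) = sign (Transposition.transpose (2 * m) (2 * m + 1)) * sign (swap_pairs m)"
    unfolding swap_pairs.simps by (intro sign_compose permutation_swap_id)
  then show ?case
    using Suc by (simp add: sign_swap_id del: swap_pairs.simps)
qed (simp add: sign_def)

lemma swap_pairs_eq: "i < 2 * m \<Longrightarrow> swap_pairs m i = (if even i then i + 1 else i - 1)"
proof (induction m)
  case (Suc m)
  show ?case
  proof (cases "i < 2 * m")
    case True
    then have "swap_pairs m i < 2 * m"
      using permutes_in_image[OF swap_pairs_permutes, of m i] by simp
    then show ?thesis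
      using Suc.IH[OF True] by (simp add: transpose_def)
  next
    case False
    then have "swap_pairs m i = i"
      using permutes_not_in[OF swap_pairs_permutes, of i m] by simp
    with False Suc.prems show ?thesis
      by (auto simp: transpose_def less_Suc_eq)
  qed
qed simp

lemma swap_pairs_div_mod:
  assumes "i < 2 * m"
  shows "swap_pairs m i div 2 = i div 2" "swap_pairs m i mod 2 = 1 - i mod 2"
  using swap_pairs_eq[OF assms] by (auto elim!: oddE evenE simp: mod2_eq_if)

text \<open>Exchanging rows 2k and 2k+1 for every k < m yields a checkerboard matrix at the cost of
  the sign (-1)^m. The row factor is a function of I div 2, so the exchange leaves it
  unchanged.\<close>

lemma det_anticheckerboard_fact:
  fixes f g :: "nat \<Rightarrow> 'a :: field_char_0"
  assumes A: "\<And>I J. I < 2 * m \<Longrightarrow> J < 2 * m \<Longrightarrow>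
      A I J = (if I mod 2 \<noteq> J mod 2 then f (I div 2) * g (J div 2) * fact (I div 2 + J div 2) else 0)"
    and "m > 0"
  shows "det (mat (2 * m) (2 * m) (\<lambda>(i, j). A i j)) =
           (-1) ^ m * (\<Prod>I<2 * m. f (I div 2) * g (I div 2) * fact (I div 2) ^ 2)"
proof -
  let ?s = "swap_pairs m"
  let ?M = "mat (2 * m) (2 * m) (\<lambda>(i, j). A i j)"
  define n where "n = 2 * m - 1"
  have n: "Suc n = 2 * m" using \<open>m > 0\<close> by (simp add: n_def)
  have lt: "?s i < 2 * m" if "i < 2 * m" for i
    using permutes_in_image[OF swap_pairs_permutes, of m i] that by simp
  have "?s permutes {0..<2 * m}"
    using swap_pairs_permutes by (simp add: lessThan_atLeast0)
  from det_permute_rows[OF _ this, of ?M]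
  have "det (mat (2 * m) (2 * m) (\<lambda>(i, j). ?M $$ (?s i, j))) = (-1) ^ m * det ?M"
    by (simp add: sign_swap_pairs)
  also have "mat (2 * m) (2 * m) (\<lambda>(i, j). ?M $$ (?s i, j)) = mat (2 * m) (2 * m) (\<lambda>(i, j). A (?s i) j)"
    by (rule eq_matI) (auto simp: lt)
  also have "det \<dots> = (\<Prod>I\<le>n. f (I div 2) * g (I div 2) * fact (I div 2) ^ 2)"
    unfolding n[symmetric]
  proof (rule det_checkerboard_fact)
    fix I J assume "I \<le> n" "J \<le> n"
    then have *: "I < 2 * m" "J < 2 * m" using n by auto
    have "1 - I mod 2 \<noteq> J mod 2 \<longleftrightarrow> I mod 2 = J mod 2" by (simp add: mod2_eq_if)
    then show "A (?s I) J = (if I mod 2 = J mod 2 then f (I div 2) * g (J div 2) * fact (I div 2 + J div 2) else 0)"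
      using A[OF lt[OF *(1)] *(2)] by (simp add: swap_pairs_div_mod[OF *(1)])
  qed
  finally have "(-1) ^ m * ((-1) ^ m * det ?M) = (-1) ^ m * (\<Prod>I\<le>n. f (I div 2) * g (I div 2) * fact (I div 2) ^ 2)"
    by simp
  moreover have "{..n} = {..<2 * m}"
    using n by auto
  ultimately show ?thesis
    by (simp add: mult.assoc[symmetric] power_add[symmetric])
qed

lemma prod_lessThan_double:
  fixes F :: "nat \<Rightarrow> 'a :: comm_monoid_mult"
  shows "(\<Prod>I<2 * n. F (I div 2)) = (\<Prod>i<n. F i) ^ 2"
  by (induction n) (simp_all add: power2_eq_square mult_ac)

subsection \<open>Moment functionals and Hankel determinants\<close>

text \<open>This is p(d/dt) G at t = 0. Hence multiplying \<open>G\<close> by exp(x t) translates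
  the argument of p by x, and exp(a t) itself acts as evaluation at a.\<close>

definition egf_functional :: "'a :: field_char_0 fps \<Rightarrow> 'a poly \<Rightarrow> 'a" where
  "egf_functional G p = (\<Sum>k\<le>degree p. coeff p k * (fact k * fps_nth G k))"

lemma egf_functional_eq:
  assumes "degree p \<le> n"
  shows "egf_functional G p = (\<Sum>k\<le>n. coeff p k * (fact k * fps_nth G k))"
  unfolding egf_functional_def
  by (rule sum.mono_neutral_left) (use assms in \<open>auto simp: coeff_eq_0\<close>)

lemma egf_functional_0 [simp]: "egf_functional G 0 = 0"
  by (simp add: egf_functional_def)

lemma egf_functional_add: "egf_functional G (p + q) = egf_functional G p + egf_functional G q"
  using egf_functional_eq[of p "max (degree p) (degree q)" G]
    egf_functional_eq[of q "max (degree p) (degree q)" G]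
    egf_functional_eq[of "p + q" "max (degree p) (degree q)" G, OF degree_add_le_max]
  by (simp add: sum.distrib algebra_simps)

lemma egf_functional_smult: "egf_functional G (smult c p) = c * egf_functional G p"
  using egf_functional_eq[of "smult c p" "degree p" G, OF degree_smult_le]
  by (simp add: egf_functional_def sum_distrib_left mult.assoc)

lemma egf_functional_diff: "egf_functional G (p - q) = egf_functional G p - egf_functional G q"
  using egf_functional_add[of G p "smult (-1) q"] egf_functional_smult[of G "-1" q] by simp

lemma egf_functional_sum: "egf_functional G (\<Sum>i\<in>S. p i) = (\<Sum>i\<in>S. egf_functional G (p i))"
  by (induction S rule: infinite_finite_induct) (auto simp: egf_functional_add)

lemma egf_functional_monom: "egf_functional G (monom c n) = c * (fact n * fps_nth G n)"
  using egf_functional_eq[of "monom c n" n G, OF degree_monom_le]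
  by (simp add: if_distrib[of "\<lambda>x. x * _"] cong: if_cong)

lemma egf_functional_add_fps: "egf_functional (F + G) p = egf_functional F p + egf_functional G p"
  by (simp add: egf_functional_def sum.distrib algebra_simps)

lemma egf_functional_const_fps: "egf_functional (fps_const c * G) p = c * egf_functional G p"
  by (simp add: egf_functional_def sum_distrib_left algebra_simps)

lemma egf_functional_exp: "egf_functional (fps_exp a) p = poly p a"
  by (simp add: egf_functional_def poly_altdef)

lemma fact_fps_exp_mult_nth:
  fixes G :: "'a :: field_char_0 fps"
  shows "fact n * fps_nth (fps_exp x * G) n =
           (\<Sum>k\<le>n. of_nat (n choose k) * x ^ (n - k) * (fact k * fps_nth G k))"
proof -
  have "fps_nth (fps_exp x * G) n = (\<Sum>k\<le>n. fps_nth G k * (x ^ (n - k) / fact (n - k)))"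
    by (subst mult.commute) (simp add: fps_mult_nth atMost_atLeast0)
  then show ?thesis
    by (auto simp: sum_distrib_left binomial_fact field_simps intro!: sum.cong)
qed

text \<open>It suffices to treat p = z^n, where the binomial expansion of (z + x)^n matches the
  Cauchy product of exp(x t) and \<open>G\<close>.\<close>

lemma egf_functional_shift:
  "egf_functional G (p \<circ>\<^sub>p [:x, 1:]) = egf_functional (fps_exp x * G) p"
proof -
  have "egf_functional G ([:x, 1:] ^ n) = fact n * fps_nth (fps_exp x * G) n" for n
    unfolding fact_fps_exp_mult_nth
    by (subst egf_functional_eq[of _ n])
      (auto simp: coeff_linear_poly_power degree_linear_power intro!: sum.cong)
  moreover have "p \<circ>\<^sub>p [:x, 1:] = (\<Sum>k\<le>degree p. smult (coeff p k) ([:x, 1:] ^ k))"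
    by (rule poly_ext) (simp add: poly_pcompose poly_sum poly_altdef[of p])
  ultimately show ?thesis
    by (simp add: egf_functional_sum egf_functional_smult) (simp add: egf_functional_def)
qed

text \<open>The matrix on the left is P H Q^T, with H the Hankel matrix and P, Q the coefficient
  matrices, which are lower triangular by the degree bounds. Rows and columns may use different
  bases.\<close>

lemma hankel_det_change_basis:
  fixes G :: "'a :: field_char_0 fps"
  assumes p: "\<And>i. degree (p i) \<le> i" and q: "\<And>i. degree (q i) \<le> i"
  shows "det (mat (Suc n) (Suc n) (\<lambda>(i, j). egf_functional G (p i * q j))) =
    (\<Prod>i\<le>n. coeff (p i) i * coeff (q i) i) * hankel_det n (\<lambda>k. fact k * fps_nth G k)"
proof -
  let ?N = "Suc n"
  let ?P = "mat ?N ?N (\<lambda>(i, j). coeff (p i) j)" and ?Q = "mat ?N ?N (\<lambda>(i, j). coeff (q i) j)"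
  let ?c = "\<lambda>k. fact k * fps_nth G k"
  let ?H = "mat ?N ?N (\<lambda>(i, j). ?c (i + j))"
  have expand: "r i = (\<Sum>k\<le>n. monom (coeff (r i) k) k)" if "degree (r i) \<le> i" "i \<le> n" for r :: "nat \<Rightarrow> 'a poly" and i
    using poly_as_sum_of_monoms'[of "r i" n] that by simp
  have entry: "egf_functional G (p i * q j) =
      (\<Sum>k\<le>n. coeff (p i) k * (\<Sum>l\<le>n. ?c (k + l) * coeff (q j) l))"
    if "i \<le> n" "j \<le> n" for i j
    by (subst expand[of p i, OF p that(1)], subst expand[of q j, OF q that(2)])
      (simp add: sum_product mult_monom egf_functional_sum egf_functional_monom sum_distrib_left mult_ac,
        rule sum.swap)
  have "mat ?N ?N (\<lambda>(i, j). egf_functional G (p i * q j)) = ?P * (?H * transpose_mat ?Q)"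
    by (rule eq_matI)
      (auto simp: entry scalar_prod_def atMost_atLeast0 atLeastLessThanSuc_atLeastAtMost)
  moreover have "?H * transpose_mat ?Q \<in> carrier_mat ?N ?N"
    by (rule mult_carrier_mat[of _ _ ?N]) auto
  ultimately have "det (mat ?N ?N (\<lambda>(i, j). egf_functional G (p i * q j))) = det ?P * (det ?H * det ?Q)"
    by (simp add: det_mult[of ?P ?N] det_mult[of ?H ?N] det_transpose[of _ ?N])
  moreover have "det ?P = (\<Prod>k\<le>n. coeff (p k) k)"
    by (subst det_lower_triangular[of ?N])
      (auto simp: prod_list_diag_prod atMost_atLeast0 atLeastLessThanSuc_atLeastAtMost
         intro!: coeff_eq_0 le_less_trans[OF p])
  moreover have "det ?Q = (\<Prod>k\<le>n. coeff (q k) k)"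
    by (subst det_lower_triangular[of ?N])
      (auto simp: prod_list_diag_prod atMost_atLeast0 atLeastLessThanSuc_atLeastAtMost
         intro!: coeff_eq_0 le_less_trans[OF q])
  ultimately show ?thesis
    by (simp add: hankel_det_def prod.distrib mult_ac)
qed

text \<open>The moments of exp(x t) G are the values of the functional on (z + x)^i (z + x)^j, and
  the basis (z + x)^i is monic. This removes the variable x from the problem.\<close>

lemma hankel_det_exp_mult:
  fixes G :: "'a :: field_char_0 fps"
  shows "hankel_det n (\<lambda>k. fact k * fps_nth (fps_exp x * G) k) = hankel_det n (\<lambda>k. fact k * fps_nth G k)"
proof -
  have "egf_functional G ([:x, 1:] ^ i * [:x, 1:] ^ j) = fact (i + j) * fps_nth (fps_exp x * G) (i + j)" for i j
    using egf_functional_shift[of G "monom 1 (i + j)" x]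
    by (simp add: egf_functional_monom power_add pcompose_altdef map_poly_monom poly_monom)
  then show ?thesis
    using hankel_det_change_basis[of "\<lambda>i. [:x, 1:] ^ i" "\<lambda>i. [:x, 1:] ^ i" n G]
    by (simp add: degree_linear_power coeff_linear_power hankel_det_def)
qed

subsection \<open>Moments of quadratic products\<close>

text \<open>The products \<phi> and \<psi> of the overview are \<open>quad_prod a h\<close> and
  \<open>quad_prod b h\<close> with step h = q.\<close>

definition quad_prod :: "'a :: field_char_0 \<Rightarrow> 'a \<Rightarrow> nat \<Rightarrow> 'a poly" where
  "quad_prod a h n = (\<Prod>k<n. [:(a + of_nat k * h) ^ 2, 0, -1:])"

lemma quad_prod_0 [simp]: "quad_prod a h 0 = 1"
  by (simp add: quad_prod_def)

lemma quad_prod_Suc: "quad_prod a h (Suc n) = quad_prod a h n * [:(a + of_nat n * h) ^ 2, 0, -1:]"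
  by (simp add: quad_prod_def)

lemma degree_lead_coeff_quad_prod:
  "degree (quad_prod a h n) = 2 * n \<and> lead_coeff (quad_prod a h n) = (-1) ^ n"
proof (induction n)
  case (Suc n)
  then have "quad_prod a h n \<noteq> 0"
    by auto
  moreover define r :: "'a poly" where "r = [:(a + of_nat n * h) ^ 2, 0, -1:]"
  moreover have "degree r = 2" "lead_coeff r = -1" "r \<noteq> 0"
    by (simp_all add: r_def)
  ultimately show ?case
    using conjunct1[OF Suc] conjunct2[OF Suc]
    unfolding quad_prod_Suc r_def[symmetric] lead_coeff_mult by (simp add: degree_mult_eq)
qed simp

lemma poly_quad_prod:
  "poly (quad_prod a h n) z = (\<Prod>k<n. a + of_nat k * h - z) * (\<Prod>k<n. a + of_nat k * h + z)"
  by (simp add: quad_prod_def poly_prod power2_eq_square algebra_simps flip: prod.distrib)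

lemma poly_quad_prod_Suc:
  "poly (quad_prod a h (Suc n)) z = poly (quad_prod a h n) z * ((a + of_nat n * h) ^ 2 - z ^ 2)"
  by (simp add: quad_prod_Suc power2_eq_square algebra_simps)

lemma poly_quad_prod_minus: "poly (quad_prod a h n) (- z) = poly (quad_prod a h n) z"
  by (simp add: poly_quad_prod mult.commute)

text \<open>The two half steps cancel in the factors with +z and add up to one full step in those
  with -z. So the product overlaps with \<open>quad_prod a h n\<close> except for one linear factor
  of each kind.\<close>

lemma poly_quad_prod_half_step:
  "poly (quad_prod (a - h / 2) h (Suc n)) (z + h / 2) =
     (a - h - z) * (a + of_nat n * h + z) * poly (quad_prod a h n) z"
proof -
  have "(\<Prod>k<Suc n. a - h / 2 + of_nat k * h - (z + h / 2)) = (\<Prod>k<Suc n. a - h + of_nat k * h - z)"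
    by (intro prod.cong) (simp_all add: field_simps)
  also have "\<dots> = (a - h - z) * (\<Prod>k<n. a + of_nat k * h - z)"
    by (subst prod.lessThan_Suc_shift) (simp add: algebra_simps)
  finally show ?thesis
    by (simp add: poly_quad_prod mult_ac add_ac)
qed

lemma poly_quad_prod_half_step':
  "poly (quad_prod (a - h / 2) h (Suc n)) (z - h / 2) =
     (a - h + z) * (a + of_nat n * h - z) * poly (quad_prod a h n) z"
  using poly_quad_prod_half_step[of a h n "- z"] poly_quad_prod_minus[of _ h _ "z - h / 2"]
  by (simp add: poly_quad_prod_minus)

text \<open>The operator r(z + h/2) + r(z - h/2) sends a product started at a - h/2 to two
  consecutive products started at a. Where a functional kills the left side, this is a first-order
  recursion for its values.\<close>

lemma half_step_sum_quad_prod: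
  fixes a h :: "'a :: field_char_0"
  defines "r \<equiv> quad_prod (a - h / 2) h"
  shows "r (Suc n) \<circ>\<^sub>p [:h / 2, 1:] + r (Suc n) \<circ>\<^sub>p [:- (h / 2), 1:] =
    smult 2 (quad_prod a h (Suc n) - smult (of_nat (Suc n) * h * (a + of_nat n * h)) (quad_prod a h n))"
proof (rule poly_ext)
  fix z :: 'a
  have e: "(a - h - z) * (a + of_nat n * h + z) * P + (a - h + z) * (a + of_nat n * h - z) * P =
    2 * (P * ((a + of_nat n * h)^2 - z^2) - (1 + of_nat n) * h * (a + of_nat n * h) * P)" for P
    by (simp add: power2_eq_square algebra_simps)
  show "poly (r (Suc n) \<circ>\<^sub>p [:h / 2, 1:] + r (Suc n) \<circ>\<^sub>p [:- (h / 2), 1:]) z = poly (smult 2 (quad_prod a h (Suc n) -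
      smult (of_nat (Suc n) * h * (a + of_nat n * h)) (quad_prod a h n))) z"
    using e[of "poly (quad_prod a h n) z"] poly_quad_prod_half_step[of a h n z] poly_quad_prod_half_step'[of a h n z]
      poly_quad_prod_Suc[of a h n z]
    by (simp add: r_def poly_pcompose add.commute)
qed

lemma half_step_sum_X_quad_prod:
  fixes a h :: "'a :: field_char_0"
  defines "r \<equiv> \<lambda>n. [:0, 1:] * quad_prod (a - h / 2) h n"
  shows "r (Suc n) \<circ>\<^sub>p [:h / 2, 1:] + r (Suc n) \<circ>\<^sub>p [:- (h / 2), 1:] =
    smult 2 ([:0, 1:] * quad_prod a h (Suc n) -
      smult (of_nat (Suc n) * h * (a + h / 2 + of_nat n * h)) ([:0, 1:] * quad_prod a h n))"
proof (rule poly_ext)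
  fix z :: 'a
  have e: "(z + h / 2) * ((a - h - z) * (a + of_nat n * h + z) * P) +
     (z - h / 2) * ((a - h + z) * (a + of_nat n * h - z) * P) =
    2 * (z * (P * ((a + of_nat n * h)^2 - z^2)) - (1 + of_nat n) * h * (a + h / 2 + of_nat n * h) * (z * P))" for P
    by (simp add: power2_eq_square field_simps)
  show "poly (r (Suc n) \<circ>\<^sub>p [:h / 2, 1:] + r (Suc n) \<circ>\<^sub>p [:- (h / 2), 1:]) z = poly (smult 2 ([:0, 1:] * quad_prod a h (Suc n) -
      smult (of_nat (Suc n) * h * (a + h / 2 + of_nat n * h)) ([:0, 1:] * quad_prod a h n))) z"
    using e[of "poly (quad_prod a h n) z"] poly_quad_prod_half_step[of a h n z] poly_quad_prod_half_step'[of a h n z]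
      poly_quad_prod_Suc[of a h n z]
    by (simp add: r_def poly_pcompose add.commute right_diff_distrib mult.left_commute)
qed

text \<open>Induction on j for all i: the new factor of the b-product is the next factor of the
  a-product plus a constant, so degree moves from j to i. The weights w = 1, z, z^2 will be used
  with c = 0, h/2, h.\<close>

lemma egf_functional_quad_prod_mult:
  fixes a b h :: "'a :: field_char_0"
  assumes ab: "a + b = h"
    and base: "\<And>i. egf_functional G (w * quad_prod a h i) =
                 K * fact i * h ^ i * (\<Prod>k<i. a + c + of_nat k * h)"
  shows "egf_functional G (w * (quad_prod a h i * quad_prod b h j)) =
           K * fact (i + j) * h ^ (i + j) *
             ((\<Prod>k<i. a + c + of_nat k * h) * (\<Prod>k<j. b + c + of_nat k * h))"
proof (induction j arbitrary: i)
  case 0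
  then show ?case using base by simp
next
  case (Suc j)
  let ?P = "w * (quad_prod a h i * quad_prod b h j)"
  have "w * (quad_prod a h i * quad_prod b h (Suc j)) =
      w * (quad_prod a h (Suc i) * quad_prod b h j) +
      smult ((b + of_nat j * h) ^ 2 - (a + of_nat i * h) ^ 2) ?P"
    by (rule poly_ext) (simp add: quad_prod_Suc algebra_simps)
  then have step: "egf_functional G (w * (quad_prod a h i * quad_prod b h (Suc j))) =
      egf_functional G (w * (quad_prod a h (Suc i) * quad_prod b h j)) +
      ((b + of_nat j * h) ^ 2 - (a + of_nat i * h) ^ 2) * egf_functional G ?P"
    by (simp add: egf_functional_add egf_functional_smult)
  have h: "h = a + b" using ab by simp
  \<comment> \<open>Since a + b = h, the difference of squares is (i + j + 1) h times (b + j h) - (a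
    + i h), which replaces the a-factor by the b-factor.\<close>
  have "of_nat (Suc (i + j)) * h * (a + c + of_nat i * h) +
      ((b + of_nat j * h) ^ 2 - (a + of_nat i * h) ^ 2) = of_nat (Suc (i + j)) * h * (b + c + of_nat j * h)"
    unfolding h by (simp add: power2_eq_square algebra_simps)
  from arg_cong[OF this, of "\<lambda>x. K * fact (i + j) * h ^ (i + j) *
      ((\<Prod>k<i. a + c + of_nat k * h) * (\<Prod>k<j. b + c + of_nat k * h)) * x"]
  show ?case
    unfolding step Suc.IH by (simp add: algebra_simps)
qed

text \<open>
  In closed form, \<open>G\<close> is \<open>cosh (g t) / cosh (h t / 2)\<close> for \<open>\<epsilon> = 1\<close> and
  \<open>sinh (g t) / cosh (h t / 2)\<close> for \<open>\<epsilon> = -1\<close>.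
\<close>

locale sech_type_egf =
  fixes G :: "'a :: field_char_0 fps" and h g \<epsilon> :: 'a
  assumes sign: "\<epsilon> = 1 \<or> \<epsilon> = -1"
    and egf: "(fps_exp (h / 2) + fps_exp (- (h / 2))) * G = fps_exp g + fps_const \<epsilon> * fps_exp (- g)"
begin

abbreviation L :: "'a poly \<Rightarrow> 'a" where "L \<equiv> egf_functional G"

text \<open>The choice of \<open>a\<close> gives the half-step product, started at a - h/2 = g, its
  roots at g and -g. Replacing g by -g turns \<open>a\<close> into \<open>b\<close>.\<close>

definition a :: 'a where "a = h / 2 + g"
definition b :: 'a where "b = h / 2 - g"

lemma a_plus_b: "a + b = h"
  by (simp add: a_def b_def)

text \<open>Translations by h/2 and -h/2 multiply \<open>G\<close> by the two exponentials in
  \<open>egf\<close>; the right side of \<open>egf\<close> then acts by evaluation at g and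
  -g.\<close>

lemma half_step:
  "L (r \<circ>\<^sub>p [:h / 2, 1:] + r \<circ>\<^sub>p [:- (h / 2), 1:]) = poly r g + \<epsilon> * poly r (- g)"
proof -
  have "L (r \<circ>\<^sub>p [:h / 2, 1:] + r \<circ>\<^sub>p [:- (h / 2), 1:]) =
      egf_functional ((fps_exp (h / 2) + fps_exp (- (h / 2))) * G) r"
    by (simp add: egf_functional_add egf_functional_shift distrib_right egf_functional_add_fps)
  then show ?thesis
    by (simp add: egf egf_functional_add_fps egf_functional_const_fps egf_functional_exp)
qed

lemma L_1: "L 1 = (1 + \<epsilon>) / 2"
  using half_step[of 1] by (simp only: pcompose_1 egf_functional_add) (simp add: field_simps)

lemma L_X: "L [:0, 1:] = (1 - \<epsilon>) * g / 2"
proof -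
  have "L (smult 2 [:0, 1:]) = (1 - \<epsilon>) * g"
    using half_step[of "[:0, 1:]"] by (simp add: pcompose_pCons algebra_simps)
  then show ?thesis
    by (simp only: egf_functional_smult) (simp add: field_simps)
qed

lemma a_minus: "a - h / 2 = g"
  by (simp add: a_def)

lemma poly_quad_prod_g [simp]:
  "poly (quad_prod g h (Suc n)) g = 0" "poly (quad_prod g h (Suc n)) (- g) = 0"
proof -
  have "(\<Prod>k<Suc n. g + of_nat k * h - g) = 0"
    by (rule prod_zero) (auto intro: bexI[of _ 0])
  then show "poly (quad_prod g h (Suc n)) g = 0"
    by (simp only: poly_quad_prod mult_zero_left)
  then show "poly (quad_prod g h (Suc n)) (- g) = 0"
    by (simp only: poly_quad_prod_minus)
qed

text \<open>Apply \<open>half_step\<close> to a product vanishing at g and -g: the right side is 0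
  and a recursion in n remains. The summand 0 stands for c in
  \<open>egf_functional_quad_prod_mult\<close>.\<close>

lemma L_quad_prod: "L (quad_prod a h n) = (1 + \<epsilon>) / 2 * fact n * h ^ n * (\<Prod>k<n. a + 0 + of_nat k * h)"
proof (induction n)
  case (Suc n)
  have "L (smult 2 (quad_prod a h (Suc n) -
      smult (of_nat (Suc n) * h * (a + of_nat n * h)) (quad_prod a h n))) = 0"
    using half_step[of "quad_prod g h (Suc n)"] half_step_sum_quad_prod[of a h n]
    by (simp add: a_minus)
  then have "L (quad_prod a h (Suc n)) = of_nat (Suc n) * h * (a + of_nat n * h) * L (quad_prod a h n)"
    by (simp add: egf_functional_smult egf_functional_diff)
  then show ?case
    by (simp add: Suc mult_ac)
qed (simp add: L_1)

lemma L_X_quad_prod: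
  "L ([:0, 1:] * quad_prod a h n) =
     (1 - \<epsilon>) * g / 2 * fact n * h ^ n * (\<Prod>k<n. a + h / 2 + of_nat k * h)"
proof (induction n)
  case (Suc n)
  have "L (smult 2 ([:0, 1:] * quad_prod a h (Suc n) -
      smult (of_nat (Suc n) * h * (a + h / 2 + of_nat n * h)) ([:0, 1:] * quad_prod a h n))) = 0"
    using half_step[of "[:0, 1:] * quad_prod g h (Suc n)"] half_step_sum_X_quad_prod[of a h n]
    by (simp only: a_minus) simp
  then have "L ([:0, 1:] * quad_prod a h (Suc n)) =
      of_nat (Suc n) * h * (a + h / 2 + of_nat n * h) * L ([:0, 1:] * quad_prod a h n)"
    by (simp only: egf_functional_smult egf_functional_diff) simp
  then show ?case
    by (simp only: Suc) (simp add: mult_ac)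
qed (use L_X in simp)

text \<open>No further recursion is needed: z^2 = (a + n h)^2 - ((a + n h)^2 - z^2) reduces to
  \<open>L_quad_prod\<close>. Splitting off the first factor a of the product gives c = h, and a (a
  - h) = -a b.\<close>

lemma L_X2_quad_prod:
  "L ([:0, 0, 1:] * quad_prod a h n) =
     (1 + \<epsilon>) / 2 * (- (a * b)) * fact n * h ^ n * (\<Prod>k<n. a + h + of_nat k * h)"
proof -
  have "[:0, 0, 1:] * quad_prod a h n = smult ((a + of_nat n * h) ^ 2) (quad_prod a h n) - quad_prod a h (Suc n)"
    by (rule poly_ext) (simp add: quad_prod_Suc power2_eq_square algebra_simps)
  then have "L ([:0, 0, 1:] * quad_prod a h n) = (a + of_nat n * h) ^ 2 * L (quad_prod a h n) - L (quad_prod a h (Suc n))"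
    by (simp only: egf_functional_smult egf_functional_diff)
  also have "\<dots> = (1 + \<epsilon>) / 2 * fact n * h ^ n * (\<Prod>k<Suc n. a + of_nat k * h) * (a - h)"
  proof -
    have "(a + of_nat n * h) ^ 2 * (e * f * u * P) - e * (of_nat (Suc n) * f) * (h * u) * (P * (a + of_nat n * h)) =
        e * f * u * (P * (a + of_nat n * h)) * (a - h)" for e f u P
      by (simp add: power2_eq_square algebra_simps)
    then show ?thesis
      unfolding L_quad_prod by simp
  qed
  also have "(\<Prod>k<Suc n. a + of_nat k * h) = a * (\<Prod>k<n. a + h + of_nat k * h)"
    by (subst prod.lessThan_Suc_shift) (simp add: algebra_simps)
  also have "a - h = - b"
    using a_plus_b by (simp add: algebra_simps)
  finally show ?thesis
    by (simp add: mult_ac)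
qed

section \<open>Parity of G, the adapted bases, and the Hankel determinants of G\<close>

lemma egf_parity: "(-1) ^ k * fps_nth G k = \<epsilon> * fps_nth G k"
proof -
  \<comment> \<open>Substitute -t for t in \<open>egf\<close>: the sum of exponentials on the left
    is even, and the right side is multiplied by \<epsilon>.\<close>
  let ?G' = "G oo (fps_const (-1) * fps_X)"
  let ?E = "fps_exp (h / 2) + fps_exp (- (h / 2))"
  have "?E * ?G' = (?E * G) oo (fps_const (-1) * fps_X)"
    by (simp add: fps_compose_mult_distrib fps_compose_add_distrib add.commute)
  also have "\<dots> = fps_exp (- g) + fps_const \<epsilon> * fps_exp g"
    unfolding egf by (simp add: fps_compose_mult_distrib fps_compose_add_distrib)
  also have "\<dots> = fps_const \<epsilon> * (?E * G)"
    unfolding egf using sign by (auto simp: algebra_simps simp flip: fps_const_neg)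
  finally have "?E * ?G' = ?E * (fps_const \<epsilon> * G)"
    by (simp add: mult_ac)
  moreover have "fps_nth ?E 0 \<noteq> 0"
    by simp
  then have "?E \<noteq> 0"
    by (metis fps_zero_nth)
  ultimately have "?G' = fps_const \<epsilon> * G"
    by simp
  then show ?thesis
    by (metis fps_nth_compose_linear fps_mult_left_const_nth)
qed

lemma L_reflect: "L (p \<circ>\<^sub>p [:0, -1:]) = \<epsilon> * L p"
proof -
  have "degree (p \<circ>\<^sub>p [:0, -1:]) \<le> degree p"
    by (simp add: degree_pcompose)
  then have "L (p \<circ>\<^sub>p [:0, -1:]) = (\<Sum>k\<le>degree p. coeff p k * (fact k * ((-1) ^ k * fps_nth G k)))"
    by (subst egf_functional_eq[of _ "degree p"]) (auto simp: coeff_pcompose_linear intro!: sum.cong)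
  then show ?thesis
    by (simp only: egf_parity) (simp add: egf_functional_def[of G p] sum_distrib_left mult_ac)
qed

text \<open>The even and odd families are interleaved so that the polynomial of index I has degree I
  and the parity of I.\<close>

definition basis_a :: "nat \<Rightarrow> 'a poly" where
  "basis_a I = monom 1 (I mod 2) * quad_prod a h (I div 2)"
definition basis_b :: "nat \<Rightarrow> 'a poly" where
  "basis_b I = monom 1 (I mod 2) * quad_prod b h (I div 2)"

lemma basis_mult:
  "basis_a I * basis_b J =
     monom 1 (I mod 2 + J mod 2) * (quad_prod a h (I div 2) * quad_prod b h (J div 2))"
proof -
  have "monom 1 (I mod 2) * monom 1 (J mod 2) = monom (1 :: 'a) (I mod 2 + J mod 2)"
    by (simp add: mult_monom)
  moreover have "(u * v) * (w * z) = (u * w) * (v * z)" for u v w z :: "'a poly"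
    by (simp only: mult_ac)
  ultimately show ?thesis
    by (simp only: basis_a_def basis_b_def)
qed

lemma degree_coeff_monom_mult_quad_prod:
  "degree (monom 1 (I mod 2) * quad_prod c h (I div 2)) = I"
  "coeff (monom 1 (I mod 2) * quad_prod c h (I div 2)) I = (-1) ^ (I div 2)"
proof -
  have q: "degree (quad_prod c h n) = 2 * n" "lead_coeff (quad_prod c h n) = (-1) ^ n" for n
    using degree_lead_coeff_quad_prod by blast+
  then have "quad_prod c h (I div 2) \<noteq> 0"
    by (metis leading_coeff_0_iff power_eq_0_iff neg_equal_0_iff_equal zero_neq_one)
  then show "degree (monom 1 (I mod 2) * quad_prod c h (I div 2)) = I"
    by (subst degree_mult_eq) (auto simp: q degree_monom_eq)
  have "I = 2 * (I div 2) + I mod 2" by simp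
  then show "coeff (monom 1 (I mod 2) * quad_prod c h (I div 2)) I = (-1) ^ (I div 2)"
    using q[of "I div 2"] by (simp add: coeff_monom_mult minus_mod_eq_mult_div)
qed

text \<open>The product has the parity of I + J, and by \<open>L_reflect\<close> the functional
  vanishes on polynomials of parity opposite to \<epsilon>.\<close>

lemma L_basis_eq_0:
  assumes "(-1) ^ (I + J) = - \<epsilon>"
  shows "L (basis_a I * basis_b J) = 0"
proof -
  have "(basis_a I * basis_b J) \<circ>\<^sub>p [:0, -1:] = smult ((-1) ^ (I + J)) (basis_a I * basis_b J)"
    by (rule poly_ext)
      (cases "even I"; cases "even J";
        simp add: basis_a_def basis_b_def poly_pcompose poly_quad_prod_minus poly_monom mod2_eq_if)
  then have "L ((basis_a I * basis_b J) \<circ>\<^sub>p [:0, -1:]) = - \<epsilon> * L (basis_a I * basis_b J)"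
    by (simp only: egf_functional_smult assms)
  then show ?thesis
    unfolding L_reflect using sign by auto
qed

lemma hankel_det_eq_det_basis:
  "hankel_det n (\<lambda>k. fact k * fps_nth G k) =
     det (mat (Suc n) (Suc n) (\<lambda>(i, j). L (basis_a i * basis_b j)))"
proof -
  have "(\<Prod>i\<le>n. coeff (basis_a i) i * coeff (basis_b i) i) = 1"
    by (intro prod.neutral)
      (simp add: basis_a_def basis_b_def degree_coeff_monom_mult_quad_prod flip: power_mult_distrib)
  then show ?thesis
    using hankel_det_change_basis[of basis_a basis_b n G]
    by (simp add: basis_a_def basis_b_def degree_coeff_monom_mult_quad_prod)
qed

text \<open>Here \<open>L\<close> kills odd polynomials, so the basis matrix is a checkerboard: even
  rows use the weight 1, odd rows the weight z^2.\<close>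

lemma hankel_det_even_egf:
  assumes "\<epsilon> = 1"
  defines "Q \<equiv> \<lambda>n. \<Prod>k<n. (a + of_nat k * h) * (b + of_nat k * h)"
  shows "hankel_det n (\<lambda>k. fact k * fps_nth G k) =
    (\<Prod>I\<le>n. (if even I then Q (I div 2) else - Q (Suc (I div 2))) *
       h ^ (2 * (I div 2)) * fact (I div 2) ^ 2)"
proof -
  \<comment> \<open>The constant -a b of the weight z^2 occurs once per entry and is assigned to the
    row factor.\<close>
  define f where "f I = (if even I then 1 else - (a * b)) * h ^ (I div 2) *
    (\<Prod>k<I div 2. a + (if even I then 0 else h) + of_nat k * h)" for I
  define f' where "f' J = h ^ (J div 2) *
    (\<Prod>k<J div 2. b + (if even J then 0 else h) + of_nat k * h)" for J
  have "L (basis_a I * basis_b J) =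
      (if I mod 2 = J mod 2 then f I * f' J * fact (I div 2 + J div 2) else 0)" for I J
  proof (cases "I mod 2 = J mod 2")
    case True
    define i j where "i = I div 2" and "j = J div 2"
    show ?thesis
    proof (cases "even I")
      case even: True
      have "L (1 * (quad_prod a h i * quad_prod b h j)) = 1 * fact (i + j) * h ^ (i + j) *
          ((\<Prod>k<i. a + 0 + of_nat k * h) * (\<Prod>k<j. b + 0 + of_nat k * h))"
        by (rule egf_functional_quad_prod_mult) (simp_all add: a_plus_b L_quad_prod assms(1))
      moreover have "basis_a I * basis_b J = 1 * (quad_prod a h i * quad_prod b h j)"
        using True even by (simp add: basis_mult i_def j_def even_iff_mod_2_eq_zero flip: one_pCons)
      moreover have "f I = h ^ i * (\<Prod>k<i. a + 0 + of_nat k * h)"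
        using even by (simp add: f_def i_def)
      moreover have "f' J = h ^ j * (\<Prod>k<j. b + 0 + of_nat k * h)"
        using even True by (simp add: f'_def j_def even_iff_mod_2_eq_zero)
      ultimately show ?thesis
        using True by (simp only: i_def[symmetric] j_def[symmetric] power_add mult_ac simp_thms if_True mult_1)
    next
      case odd: False
      have "L ([:0, 0, 1:] * (quad_prod a h i * quad_prod b h j)) = (- (a * b)) * fact (i + j) * h ^ (i + j) *
          ((\<Prod>k<i. a + h + of_nat k * h) * (\<Prod>k<j. b + h + of_nat k * h))"
        by (rule egf_functional_quad_prod_mult) (simp_all only: a_plus_b L_X2_quad_prod assms(1), simp)
      moreover have "basis_a I * basis_b J = [:0, 0, 1:] * (quad_prod a h i * quad_prod b h j)"
      proof -
        have "I mod 2 + J mod 2 = 2"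
          using True odd by (simp add: mod2_eq_if split: if_splits)
        moreover have "monom 1 2 = [:0, 0, 1 :: 'a:]"
          by (simp add: monom_altdef power2_eq_square)
        ultimately show ?thesis
          by (simp only: basis_mult i_def j_def)
      qed
      moreover have "f I = - (a * b) * h ^ i * (\<Prod>k<i. a + h + of_nat k * h)"
        using odd by (simp add: f_def i_def)
      moreover have "f' J = h ^ j * (\<Prod>k<j. b + h + of_nat k * h)"
        using odd True by (simp add: f'_def j_def even_iff_mod_2_eq_zero)
      ultimately show ?thesis
        using True by (simp only: i_def[symmetric] j_def[symmetric] power_add mult_ac simp_thms if_True)
    qed
  next
    case False
    then have "(-1 :: 'a) ^ (I + J) = -1"
      by (auto simp: mod2_eq_if minus_one_power_iff split: if_splits)
    with False show ?thesis
      using L_basis_eq_0[of I J] assms(1) by simp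
  qed
  from det_checkerboard_fact[OF this]
  have "hankel_det n (\<lambda>k. fact k * fps_nth G k) = (\<Prod>I\<le>n. f I * f' I * fact (I div 2) ^ 2)"
    unfolding hankel_det_eq_det_basis .
  moreover have "f I * f' I = (if even I then Q (I div 2) else - Q (Suc (I div 2))) * h ^ (2 * (I div 2))" for I
  proof (cases "even I")
    case True
    then show ?thesis
      by (simp add: f_def f'_def Q_def prod.distrib mult_2 power_add mult_ac)
  next
    case False
    \<comment> \<open>The constant a b supplies the factor k = 0 missing from the products started
      at a + h and b + h.\<close>
    have "Q (Suc n) = a * b * ((\<Prod>k<n. a + h + of_nat k * h) * (\<Prod>k<n. b + h + of_nat k * h))" for n
      unfolding Q_def prod.lessThan_Suc_shift prod.distrib by (simp add: algebra_simps)
    with False show ?thesis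
      by (simp add: f_def f'_def mult_2 power_add mult_ac)
  qed
  ultimately show ?thesis
    by simp
qed

text \<open>Now \<open>L\<close> kills even polynomials, so entries survive only for opposite
  parities, with weight z. The sign comes from the m + 1 row exchanges.\<close>

lemma hankel_det_odd_egf:
  assumes "\<epsilon> = -1"
  shows "hankel_det (2 * m + 1) (\<lambda>k. fact k * fps_nth G k) =
    (-1) ^ (m + 1) * (\<Prod>i\<le>m. g * h ^ (2 * i) * fact i ^ 2 *
       (\<Prod>k<i. (a + h / 2 + of_nat k * h) * (b + h / 2 + of_nat k * h))) ^ 2"
proof -
  define f where "f i = g * h ^ i * (\<Prod>k<i. a + h / 2 + of_nat k * h)" for i
  define f' where "f' j = h ^ j * (\<Prod>k<j. b + h / 2 + of_nat k * h)" for j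
  have entry: "L (basis_a I * basis_b J) =
      (if I mod 2 \<noteq> J mod 2 then f (I div 2) * f' (J div 2) * fact (I div 2 + J div 2) else 0)" for I J
  proof (cases "I mod 2 = J mod 2")
    case False
    define i j where "i = I div 2" and "j = J div 2"
    have "L ([:0, 1:] * (quad_prod a h i * quad_prod b h j)) = g * fact (i + j) * h ^ (i + j) *
        ((\<Prod>k<i. a + h / 2 + of_nat k * h) * (\<Prod>k<j. b + h / 2 + of_nat k * h))"
      by (rule egf_functional_quad_prod_mult) (simp_all only: a_plus_b L_X_quad_prod assms(1), simp)
    moreover have "basis_a I * basis_b J = [:0, 1:] * (quad_prod a h i * quad_prod b h j)"
    proof -
      have "I mod 2 + J mod 2 = 1"
        using False by (auto simp: mod2_eq_if split: if_splits)
      moreover have "monom 1 1 = [:0, 1 :: 'a:]"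
        by (simp add: monom_altdef)
      ultimately show ?thesis
        by (simp only: basis_mult i_def j_def)
    qed
    ultimately show ?thesis
      using False
      by (simp only: f_def f'_def i_def[symmetric] j_def[symmetric] power_add mult_ac simp_thms if_True not_False_eq_True)
  next
    case True
    then have "(-1 :: 'a) ^ (I + J) = 1"
      by (auto simp: mod2_eq_if minus_one_power_iff split: if_splits)
    with True show ?thesis
      using L_basis_eq_0[of I J] assms(1) by simp
  qed
  have "hankel_det (2 * m + 1) (\<lambda>k. fact k * fps_nth G k) =
      (-1) ^ Suc m * (\<Prod>I<2 * Suc m. f (I div 2) * f' (I div 2) * fact (I div 2) ^ 2)"
    unfolding hankel_det_eq_det_basis
    using det_anticheckerboard_fact[of "Suc m" "\<lambda>I J. L (basis_a I * basis_b J)", OF entry] by simp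
  also have "(\<Prod>I<2 * Suc m. f (I div 2) * f' (I div 2) * fact (I div 2) ^ 2) =
      (\<Prod>i\<le>m. f i * f' i * fact i ^ 2) ^ 2"
    by (simp only: prod_lessThan_double[of "\<lambda>i. f i * f' i * fact i ^ 2"] lessThan_Suc_atMost)
  moreover have "f i * f' i * fact i ^ 2 = g * h ^ (2 * i) * fact i ^ 2 *
       (\<Prod>k<i. (a + h / 2 + of_nat k * h) * (b + h / 2 + of_nat k * h))" for i
    by (simp add: f_def f'_def prod.distrib mult_2 mult_2_right power_add mult_ac)
  ultimately show ?thesis
    by simp
qed

text \<open>Using the basis (-z)^i on both sides preserves the determinant but negates every entry,
  and the size 2m + 1 is odd.\<close>

lemma hankel_det_odd_egf_eq_0:
  assumes "\<epsilon> = -1"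
  shows "hankel_det (2 * m) (\<lambda>k. fact k * fps_nth G k) = 0"
proof -
  let ?c = "\<lambda>k. fact k * fps_nth G k"
  define H where "H = mat (2 * m + 1) (2 * m + 1) (\<lambda>(i, j). ?c (i + j))"
  have "L (([:0, -1:] ^ i) * ([:0, -1:] ^ j)) = - ?c (i + j)" for i j
  proof -
    have "monom 1 (i + j) \<circ>\<^sub>p [:0, -1:] = [:0, -1 :: 'a:] ^ i * [:0, -1:] ^ j"
      by (intro poly_ext) (simp add: poly_pcompose poly_monom power_add)
    then show ?thesis
      using L_reflect[of "monom 1 (i + j)"] assms by (simp add: egf_functional_monom)
  qed
  then have "mat (Suc (2 * m)) (Suc (2 * m)) (\<lambda>(i, j). L (([:0, -1:] ^ i) * ([:0, -1:] ^ j))) = (-1) \<cdot>\<^sub>m H"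
    by (intro eq_matI) (auto simp: H_def)
  moreover have "det (mat (Suc (2 * m)) (Suc (2 * m)) (\<lambda>(i, j). L (([:0, -1:] ^ i) * ([:0, -1:] ^ j)))) =
      (\<Prod>i\<le>2 * m. coeff ([:0, -1:] ^ i) i * coeff ([:0, -1:] ^ i) i) * hankel_det (2 * m) ?c"
    by (intro hankel_det_change_basis) (simp_all add: degree_power_eq)
  moreover have "(\<Prod>i\<le>2 * m. coeff ([:0, -1:] ^ i) i * coeff ([:0, -1:] ^ i) i) = (1 :: 'a)"
    by (intro prod.neutral) (simp flip: power_mult_distrib)
  ultimately have "- det H = det H"
    by (simp add: hankel_det_def H_def)
  then show ?thesis
    by (simp add: hankel_det_def H_def)
qed

end

subsection \<open>Generalized Bernoulli polynomials\<close>

text \<open>As the character sums to 0, the numerator vanishes at t = 0 and absorbs the simple zero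
  of the denominator. The explicit factor t thus stays outside and produces the index shift in
  B_{k+1}/(k+1).\<close>

lemma gen_bernoulli_egf_factor:
  assumes "N > 0" and chi: "(\<Sum>a=1..N. chi a) = 0"
  obtains G where "gen_bernoulli_egf N chi = fps_X * G"
    "G * (fps_exp 1 ^ N - 1) = (\<Sum>a=1..N. fps_const (chi a) * fps_exp 1 ^ a)"
proof -
  define D :: "complex fps" where "D = fps_exp 1 ^ N - 1"
  define S where "S = (\<Sum>a=1..N. fps_const (chi a) * fps_exp 1 ^ a)"
  have exp_nat: "fps_exp (of_nat a) = (fps_exp 1 :: complex fps) ^ a" for a
    by (simp add: fps_exp_power_mult)
  have nth_D: "fps_nth D 0 = 0" "fps_nth D 1 \<noteq> 0"
    using \<open>N > 0\<close> by (simp_all add: D_def flip: exp_nat)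
  then have "subdegree D = 1"
    by (intro subdegreeI) auto
  have "D \<noteq> 0"
    using nth_D by auto
  have "D dvd fps_X"
    using \<open>D \<noteq> 0\<close> \<open>subdegree D = 1\<close> by (simp add: fps_dvd_iff)
  then have quot: "(fps_const (chi a) * fps_X * fps_exp (of_nat a)) / D * D =
      fps_X * (fps_const (chi a) * fps_exp 1 ^ a)" for a
    by (subst dvd_div_mult_self) (auto simp: exp_nat mult_ac)
  have "gen_bernoulli_egf N chi * D = fps_X * S"
    by (simp only: gen_bernoulli_egf_def sum_distrib_right sum_distrib_left quot S_def
        D_def[unfolded exp_nat[symmetric], symmetric])
  moreover have "fps_nth S 0 = 0"
    using chi by (simp add: S_def fps_sum_nth flip: exp_nat)
  then have "fps_X dvd S"
  proof (cases "S = 0")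
    case False
    with \<open>fps_nth S 0 = 0\<close> have "subdegree S \<noteq> 0"
      by (metis nth_subdegree_nonzero)
    with False show ?thesis
      by (simp add: fps_dvd_iff Suc_le_eq)
  qed simp
  with \<open>D dvd fps_X\<close> have "D dvd S"
    by (rule dvd_trans)
  then have "S div D * D = S"
    by simp
  ultimately have "gen_bernoulli_egf N chi * D = (fps_X * (S div D)) * D"
    by (simp add: mult.assoc)
  then have "gen_bernoulli_egf N chi = fps_X * (S div D)"
    using \<open>D \<noteq> 0\<close> by simp
  with \<open>S div D * D = S\<close> show ?thesis
    using that unfolding S_def D_def by blast
qed

lemma poly_gen_bernpoly:
  "poly (gen_bernpoly N chi n) x = fact n * fps_nth (fps_exp x * gen_bernoulli_egf N chi) n"
  unfolding fact_fps_exp_mult_nth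
  by (simp add: gen_bernpoly_def gen_bernoulli_def poly_sum poly_monom atMost_atLeast0 mult_ac)

lemma poly_gen_bernpoly_moment:
  assumes "gen_bernoulli_egf N chi = fps_X * G"
  shows "poly (smult (1 / of_nat (k + 1)) (gen_bernpoly N chi (k + 1))) x = fact k * fps_nth (fps_exp x * G) k"
proof -
  have "fps_exp x * (fps_X * G) = fps_X * (fps_exp x * G)"
    by (simp add: mult_ac)
  then have "fps_nth (fps_exp x * (fps_X * G)) (Suc k) = fps_nth (fps_exp x * G) k"
    by (simp only: fps_X_mult_nth) simp
  moreover have "(1 + of_nat k :: complex) \<noteq> 0"
    using of_nat_neq_0[of k, where 'a = complex] by simp
  ultimately show ?thesis
    by (simp add: poly_gen_bernpoly assms)
qed

lemma hankel_det_uminus: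
  fixes c :: "nat \<Rightarrow> 'a :: comm_ring_1"
  shows "hankel_det n (\<lambda>k. - c k) = (-1) ^ (n + 1) * hankel_det n c"
proof -
  have "mat (n + 1) (n + 1) (\<lambda>(i, j). - c (i + j)) = (-1) \<cdot>\<^sub>m mat (n + 1) (n + 1) (\<lambda>(i, j). c (i + j))"
    by (rule eq_matI) auto
  then show ?thesis
    by (simp add: hankel_det_def)
qed

lemma poly_hankel_det: "poly (hankel_det n b) x = hankel_det n (\<lambda>k. poly (b k) x)"
proof -
  interpret comm_ring_hom "\<lambda>p. poly p x"
    by unfold_locales auto
  have "map_mat (\<lambda>p. poly p x) (mat (n + 1) (n + 1) (\<lambda>(i, j). b (i + j))) =
      mat (n + 1) (n + 1) (\<lambda>(i, j). poly (b (i + j)) x)"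
    by (rule eq_matI) auto
  then show ?thesis
    unfolding hankel_det_def hom_det[symmetric] by simp
qed

lemma hankel_det_poly_constI:
  fixes b :: "nat \<Rightarrow> complex poly"
  assumes "\<And>x. hankel_det n (\<lambda>k. poly (b k) x) = c"
  shows "hankel_det n b = [:c:]"
  by (rule poly_ext) (simp add: poly_hankel_det assms)

text \<open>All four characters satisfy chi(a + q) = -chi(a), hence the common factor E^q - 1;
  within one half period they are supported on 1 and q - 1.\<close>

lemma character_sums:
  fixes q :: nat and chi1 chi2 :: "nat \<Rightarrow> complex" and E :: "complex fps"
  assumes "(q = 4 \<and> chi1 = chi_8_1 \<and> chi2 = chi_8_2) \<or>
           (q = 6 \<and> chi1 = chi_12_1 \<and> chi2 = chi_12_2)"
  shows "(\<Sum>a=1..2 * q. chi1 a) = 0" "(\<Sum>a=1..2 * q. chi2 a) = 0"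
    "(\<Sum>a=1..2 * q. fps_const (chi1 a) * E ^ a) = (E ^ q - 1) * (E ^ (q - 1) - E)"
    "(\<Sum>a=1..2 * q. fps_const (chi2 a) * E ^ a) = - ((E ^ q - 1) * (E ^ (q - 1) + E))"
proof -
  have 8: "{Suc 0..8} = {1, 2, 3, 4, 5, 6, 7, 8 :: nat}"
    by auto
  have "{Suc 0..12} = {Suc 0..8} \<union> {9..12 :: nat}" "{9..12} = {9, 10, 11, 12 :: nat}"
    by auto
  then have 12: "{Suc 0..12} = {1, 2, 3, 4, 5, 6, 7, 8, 9, 10, 11, 12 :: nat}"
    by (simp only: 8) auto
  have expand:
      "(E ^ 4 - 1) * (E ^ 3 - E) = E - E ^ 3 - E ^ 5 + E ^ 7"
      "(E ^ 4 - 1) * (E ^ 3 + E) = - E - E ^ 3 + E ^ 5 + E ^ 7"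
      "(E ^ 6 - 1) * (E ^ 5 - E) = E - E ^ 5 - E ^ 7 + E ^ 11"
      "(E ^ 6 - 1) * (E ^ 5 + E) = - E - E ^ 5 + E ^ 7 + E ^ 11"
    by (simp_all add: eval_nat_numeral algebra_simps)
  show "(\<Sum>a=1..2 * q. chi1 a) = 0" "(\<Sum>a=1..2 * q. chi2 a) = 0"
    using assms by (auto simp: 8 12 chi_8_1_def chi_8_2_def chi_12_1_def chi_12_2_def)
  show "(\<Sum>a=1..2 * q. fps_const (chi1 a) * E ^ a) = (E ^ q - 1) * (E ^ (q - 1) - E)"
    using assms by (auto simp: 8 12 chi_8_1_def chi_12_1_def expand simp flip: fps_const_neg)
  show "(\<Sum>a=1..2 * q. fps_const (chi2 a) * E ^ a) = - ((E ^ q - 1) * (E ^ (q - 1) + E))"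
    using assms by (auto simp: 8 12 chi_8_2_def chi_12_2_def expand simp flip: fps_const_neg)
qed

text \<open>Multiplication by exp(-q t/2) makes the equation symmetric.\<close>

lemma sech_type_egf_of_half_sum:
  fixes G :: "complex fps"
  assumes "q > 0" and "\<epsilon> = 1 \<or> \<epsilon> = -1"
    and G: "G * (fps_exp 1 ^ q + 1) = fps_exp 1 ^ (q - 1) + fps_const \<epsilon> * fps_exp 1"
  shows "sech_type_egf G (of_nat q) (of_nat q / 2 - 1) \<epsilon>"
proof
  let ?h = "of_nat q / 2 :: complex"
  have exp_nat: "fps_exp 1 ^ a = (fps_exp (of_nat a) :: complex fps)" for a
    by (simp add: fps_exp_power_mult)
  have "(fps_exp ?h + fps_exp (- ?h)) * G = fps_exp (- ?h) * (G * (fps_exp 1 ^ q + 1))"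
    by (simp add: exp_nat algebra_simps flip: fps_exp_add_mult)
  also have "\<dots> = fps_exp (?h - 1) + fps_const \<epsilon> * fps_exp (- (?h - 1))"
    using \<open>q > 0\<close> unfolding G
    by (simp add: exp_nat distrib_left mult.left_commute[of _ "fps_const \<epsilon>"] of_nat_diff flip: fps_exp_add_mult)
  finally show "(fps_exp ?h + fps_exp (- ?h)) * G = fps_exp (?h - 1) + fps_const \<epsilon> * fps_exp (- (?h - 1))" .
qed (fact assms(2))

subsection \<open>Closed forms of the products\<close>

text \<open>Each exponent grows by 2, and the new index enters with exponent 2, so the quotient is
  the square of the full product.\<close>

lemma prod_power_descending_Suc:
  fixes Y :: "nat \<Rightarrow> 'a :: comm_semiring_1"
  shows "(\<Prod>l=1..Suc m. Y l ^ (2 * (Suc m + 1 - l))) =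
    (\<Prod>l=1..m. Y l ^ (2 * (m + 1 - l))) * (\<Prod>l=1..Suc m. Y l) ^ 2"
proof -
  have "(\<Prod>l=1..m. Y l ^ (2 * (Suc m + 1 - l))) = (\<Prod>l=1..m. Y l ^ (2 * (m + 1 - l)) * Y l ^ 2)"
  proof (rule prod.cong)
    fix l assume "l \<in> {1..m}"
    then have "2 * (Suc m + 1 - l) = 2 * (m + 1 - l) + 2" by auto
    then show "Y l ^ (2 * (Suc m + 1 - l)) = Y l ^ (2 * (m + 1 - l)) * Y l ^ 2"
      by (simp only: power_add)
  qed simp
  then show ?thesis
    by (simp add: prod.distrib power_mult_distrib prod_power_distrib mult_ac)
qed

text \<open>With l = k + 1 and g = (q - 2)/2 the two factors are l q + g and l q - g; their product
  is a difference of squares.\<close>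

lemma prod_chi1_factors:
  fixes q :: complex
  assumes "q \<noteq> 0"
  shows "fact i ^ 2 * (\<Prod>k<i. (q - 1 + q / 2 + of_nat k * q) * (1 + q / 2 + of_nat k * q)) =
    (- (q ^ 2)) ^ i * (\<Prod>l=1..i. of_nat l ^ 2 / 4 * (((q - 2) / q) ^ 2 - (2 * of_nat l) ^ 2))"
proof (induction i)
  case (Suc i)
  have "of_nat (Suc i) ^ 2 * ((q - 1 + q / 2 + of_nat i * q) * (1 + q / 2 + of_nat i * q)) =
      - (q ^ 2) * (of_nat (Suc i) ^ 2 / 4 * (((q - 2) / q) ^ 2 - (2 * of_nat (Suc i)) ^ 2))"
    using assms by (simp add: power2_eq_square field_simps)
  from arg_cong2[OF Suc this, of "(*)"] show ?case
    by (simp add: power_mult_distrib mult_ac del: of_nat_Suc)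
qed simp

text \<open>As for the first character, now with the factors (l - 1/2) q + g and (l - 1/2) q -
  g.\<close>

lemma prod_chi2_factors:
  fixes q :: complex
  assumes "q \<noteq> 0"
  shows "fact i ^ 2 * (\<Prod>k<i. (q - 1 + of_nat k * q) * (1 + of_nat k * q)) =
    (- (q ^ 2)) ^ i * (\<Prod>l=1..i. of_nat l ^ 2 / 4 * (((q - 2) / q) ^ 2 - (2 * of_nat l - 1) ^ 2))"
proof (induction i)
  case (Suc i)
  have "of_nat (Suc i) ^ 2 * ((q - 1 + of_nat i * q) * (1 + of_nat i * q)) =
      - (q ^ 2) * (of_nat (Suc i) ^ 2 / 4 * (((q - 2) / q) ^ 2 - (2 * of_nat (Suc i) - 1) ^ 2))"
    using assms by (simp add: power2_eq_square field_simps)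
  from arg_cong2[OF Suc this, of "(*)"] show ?case
    by (simp add: power_mult_distrib mult_ac del: of_nat_Suc)
qed simp

lemma prod_chi2_factors':
  fixes q :: complex
  assumes "q \<noteq> 0"
  shows "4 ^ i * (\<Prod>k<i. (q - 1 + of_nat k * q) * (1 + of_nat k * q)) =
    (- (q ^ 2)) ^ i * (\<Prod>l<i. ((q - 2) / q) ^ 2 - (2 * of_nat l + 1) ^ 2)"
proof (induction i)
  case (Suc i)
  have "4 * ((q - 1 + of_nat i * q) * (1 + of_nat i * q)) =
      - (q ^ 2) * (((q - 2) / q) ^ 2 - (2 * of_nat i + 1) ^ 2)"
    using assms by (simp add: power2_eq_square field_simps)
  from arg_cong2[OF Suc this, of "(*)"] show ?case
    by (simp add: mult_ac)
qed simp

lemma power2_neg_square_power: "((- (q ^ 2)) ^ n) ^ 2 = q ^ (4 * n)" for q :: "'a :: comm_ring_1"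
proof -
  have "((- (q ^ 2)) ^ n) ^ 2 = ((- (q ^ 2)) ^ 2) ^ n"
    by (simp only: mult.commute flip: power_mult)
  then show ?thesis
    by (simp add: power_mult)
qed

lemma prod_h1:
  fixes q :: complex
  assumes "q \<noteq> 0"
  shows "(\<Prod>i\<le>m. (q / 2 - 1) * q ^ (2 * i) * fact i ^ 2 *
       (\<Prod>k<i. (q - 1 + q / 2 + of_nat k * q) * (1 + q / 2 + of_nat k * q))) ^ 2 =
    ((q - 2) / 2 * q ^ (2 * m)) ^ (2 * m + 2) *
      (\<Prod>l=1..m. (of_nat l ^ 2 / 4 * (((q - 2) / q) ^ 2 - (2 * of_nat l) ^ 2)) ^ (2 * (m + 1 - l)))"
proof (induction m)
  case 0
  show ?case by (simp add: diff_divide_distrib power2_eq_square)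
next
  case (Suc m)
  define Y where "Y l = of_nat l ^ 2 / 4 * (((q - 2) / q) ^ 2 - (2 * of_nat l) ^ 2)" for l :: nat
  define n where "n = Suc m"
  have "((q / 2 - 1) * q ^ (2 * n) * (fact n ^ 2 *
       (\<Prod>k<n. (q - 1 + q / 2 + of_nat k * q) * (1 + q / 2 + of_nat k * q)))) ^ 2 =
     ((q - 2) / 2) ^ 2 * q ^ (8 * n) * (\<Prod>l=1..n. Y l) ^ 2"
  proof -
    \<comment> \<open>Half of the exponent comes from the explicit powers of the step, half from
      \<open>prod_chi1_factors\<close>.\<close>
    have q8: "(q ^ (2 * n)) ^ 2 * ((- (q ^ 2)) ^ n) ^ 2 = q ^ (8 * n)"
      unfolding power2_neg_square_power by (simp flip: power_mult power_add)
    have half: "q / 2 - 1 = (q - 2) / 2"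
      by (simp add: diff_divide_distrib)
    have square: "(g * u * (v * w)) ^ 2 = g ^ 2 * (u ^ 2 * v ^ 2) * w ^ 2" for g u v w :: complex
      by (simp only: power_mult_distrib mult_ac)
    show ?thesis
      unfolding prod_chi1_factors[OF assms] Y_def[symmetric] square half q8 ..
  qed
  moreover have "((q - 2) / 2 * q ^ (2 * Suc m)) ^ (2 * Suc m + 2) =
      ((q - 2) / 2 * q ^ (2 * m)) ^ (2 * m + 2) * (((q - 2) / 2) ^ 2 * q ^ (8 * n))"
  proof -
    have "2 * Suc m * (2 * Suc m + 2) = 2 * m * (2 * m + 2) + 8 * n"
      by (simp add: n_def algebra_simps)
    then have "(q ^ (2 * Suc m)) ^ (2 * Suc m + 2) = (q ^ (2 * m)) ^ (2 * m + 2) * q ^ (8 * n)"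
      by (metis power_mult power_add)
    moreover have "((q - 2) / 2) ^ (2 * Suc m + 2) = ((q - 2) / 2) ^ (2 * m + 2) * ((q - 2) / 2) ^ 2"
      by (simp only: flip: power_add) simp
    ultimately show ?thesis
      unfolding power_mult_distrib by (simp only: mult_ac)
  qed
  ultimately show ?case
    unfolding prod.atMost_Suc power_mult_distrib[of "prod _ _"] Suc.IH prod_power_descending_Suc Y_def[symmetric] n_def
    by (simp only: mult_ac)
qed

text \<open>Raising m by 1 adds the indices 2m + 1 and 2m + 2, which carry -Q(m + 1) and Q(m + 1).
  The factorials leave m!^2/(m + 1)!^2, which telescopes to 1/m!^2.\<close>

lemma prod_h2:
  fixes q :: complex
  assumes "q \<noteq> 0"
  defines "Q \<equiv> \<lambda>n. \<Prod>k<n. (q - 1 + of_nat k * q) * (1 + of_nat k * q)"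
  shows "(\<Prod>I\<le>2 * m. (if even I then Q (I div 2) else - Q (Suc (I div 2))) *
       q ^ (2 * (I div 2)) * fact (I div 2) ^ 2) =
    (-1) ^ m * (q ^ (2 * m * (2 * m + 1)) / (fact m) ^ 2) *
      (\<Prod>l=1..m. (of_nat l ^ 2 / 4 * (((q - 2) / q) ^ 2 - (2 * of_nat l - 1) ^ 2)) ^ (2 * (m + 1 - l)))"
proof (induction m)
  case 0
  show ?case by (simp add: Q_def)
next
  case (Suc m)
  define Y where "Y l = of_nat l ^ 2 / 4 * (((q - 2) / q) ^ 2 - (2 * of_nat l - 1) ^ 2)" for l :: nat
  define P where "P = (\<Prod>l=1..Suc m. Y l)"
  define R where "R = (\<Prod>l=1..m. Y l ^ (2 * (m + 1 - l)))"
  let ?F = "\<lambda>I. (if even I then Q (I div 2) else - Q (Suc (I div 2))) * q ^ (2 * (I div 2)) * fact (I div 2) ^ 2"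
  have Q: "Q (Suc m) = (- (q ^ 2)) ^ Suc m * P / fact (Suc m) ^ 2"
  proof -
    have "fact (Suc m) ^ 2 * Q (Suc m) = (- (q ^ 2)) ^ Suc m * P"
      using prod_chi2_factors[OF assms(1), of "Suc m"] unfolding Q_def P_def Y_def .
    then show ?thesis
      by (simp add: eq_divide_eq mult.commute del: fact_Suc power_Suc)
  qed
  have "(\<Prod>I\<le>2 * Suc m. ?F I) = (\<Prod>I\<le>2 * m. ?F I) *
      ((- Q (Suc m) * q ^ (2 * m) * fact m ^ 2) * (Q (Suc m) * q ^ (2 * Suc m) * fact (Suc m) ^ 2))"
    by (simp add: mult_ac)
  also have "(- Q (Suc m) * q ^ (2 * m) * fact m ^ 2) * (Q (Suc m) * q ^ (2 * Suc m) * fact (Suc m) ^ 2) =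
      - (q ^ (8 * m + 6) * fact m ^ 2 / fact (Suc m) ^ 2 * P ^ 2)"
  proof -
    have "(u * P / f\<^sup>2) * (u * P / f\<^sup>2) * f ^ 2 = u ^ 2 * P ^ 2 / f ^ 2" if "f \<noteq> 0" for u f :: complex
      using that by (simp add: power2_eq_square)
    then have QQ: "Q (Suc m) * Q (Suc m) * fact (Suc m) ^ 2 =
        ((- (q ^ 2)) ^ Suc m) ^ 2 * P ^ 2 / fact (Suc m) ^ 2"
      unfolding Q using fact_nonzero by blast
    have w: "((- (q ^ 2)) ^ Suc m) ^ 2 * (q ^ (2 * m) * q ^ (2 * Suc m)) = q ^ (8 * m + 6)"
    proof -
      have "4 * Suc m + (2 * m + 2 * Suc m) = 8 * m + 6"
        by simp
      then show ?thesis
        by (simp only: power2_neg_square_power flip: power_add)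
    qed
    have "(- Q (Suc m) * q ^ (2 * m) * fact m ^ 2) * (Q (Suc m) * q ^ (2 * Suc m) * fact (Suc m) ^ 2) =
      - (Q (Suc m) * Q (Suc m) * fact (Suc m) ^ 2) * (q ^ (2 * m) * q ^ (2 * Suc m)) * fact m ^ 2"
      by (simp only: mult_ac mult_minus_left mult_minus_right)
    then show ?thesis
      unfolding QQ w[symmetric]
      by (simp only: times_divide_eq_left times_divide_eq_right mult_minus_left mult_minus_right mult_ac)
  qed
  finally have *: "(\<Prod>I\<le>2 * Suc m. ?F I) =
      (-1) ^ m * (q ^ (2 * m * (2 * m + 1)) / (fact m) ^ 2) * R *
      - (q ^ (8 * m + 6) * fact m ^ 2 / fact (Suc m) ^ 2 * P ^ 2)"
    unfolding Suc.IH R_def Y_def .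
  have "2 * Suc m * (2 * Suc m + 1) = 2 * m * (2 * m + 1) + (8 * m + 6)"
    by (simp add: algebra_simps)
  then have "q ^ (2 * Suc m * (2 * Suc m + 1)) = q ^ (2 * m * (2 * m + 1)) * q ^ (8 * m + 6)"
    by (simp only: power_add)
  then show ?case
    unfolding * prod_power_descending_Suc Y_def[symmetric] P_def[symmetric] R_def[symmetric]
    by (simp del: fact_Suc)
qed

text \<open>The added indices 2m + 2 and 2m + 3 carry Q(m + 1) and -Q(m + 2), hence a square times
  one new factor. Of the denominator 4^(2m + 3) = 4 * 16^(m + 1), the 4 goes to the power of 1/2 and
  the rest into the product.\<close>

lemma prod_h3:
  fixes q :: complex
  assumes "q \<noteq> 0"
  defines "Q \<equiv> \<lambda>n. \<Prod>k<n. (q - 1 + of_nat k * q) * (1 + of_nat k * q)"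
  shows "(\<Prod>I\<le>2 * m + 1. (if even I then Q (I div 2) else - Q (Suc (I div 2))) *
       q ^ (2 * (I div 2)) * fact (I div 2) ^ 2) =
    (1 / 2 * q ^ (2 * m + 1)) ^ (2 * m + 2) *
      (\<Prod>l=0..m. fact l ^ 4 / 16 ^ l * (((q - 2) / q) ^ 2 - (2 * of_nat l + 1) ^ 2) ^ (2 * (m - l) + 1))"
proof (induction m)
  case 0
  show ?case
    using assms(1) by (simp add: Q_def power2_eq_square field_simps)
next
  case (Suc m)
  define Z where "Z l = ((q - 2) / q) ^ 2 - (2 * of_nat l + 1) ^ 2" for l :: nat
  define P where "P = (\<Prod>l<Suc m. Z l)"
  define R where "R = (\<Prod>l=0..m. fact l ^ 4 / 16 ^ l * Z l ^ (2 * (m - l) + 1))"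
  let ?F = "\<lambda>I. (if even I then Q (I div 2) else - Q (Suc (I div 2))) * q ^ (2 * (I div 2)) * fact (I div 2) ^ 2"
  have Q: "Q n = (- (q ^ 2)) ^ n * (\<Prod>l<n. Z l) / 4 ^ n" for n
    using prod_chi2_factors'[OF assms(1), of n] by (simp add: Q_def Z_def field_simps)
  have "(\<Prod>I\<le>2 * Suc m + 1. ?F I) = (\<Prod>I\<le>2 * m + 1. ?F I) *
      ((Q (Suc m) * q ^ (2 * Suc m) * fact (Suc m) ^ 2) * (- Q (Suc (Suc m)) * q ^ (2 * Suc m) * fact (Suc m) ^ 2))"
    by (simp add: mult_ac)
  also have "(Q (Suc m) * q ^ (2 * Suc m) * fact (Suc m) ^ 2) * (- Q (Suc (Suc m)) * q ^ (2 * Suc m) * fact (Suc m) ^ 2) =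
      q ^ (8 * m + 10) / 4 ^ (2 * m + 3) * (fact (Suc m) ^ 4 * (P ^ 2 * Z (Suc m)))"
  proof -
    have exponent: "Suc m + Suc (Suc m) = 2 * m + 3"
      by simp
    have qq: "(- (q ^ 2)) ^ Suc m * (- (q ^ 2)) ^ Suc (Suc m) = - (q ^ (4 * m + 6))"
    proof -
      have "(- (q ^ 2)) ^ Suc m * (- (q ^ 2)) ^ Suc (Suc m) = (- (q ^ 2)) ^ (2 * m + 3)"
        by (simp only: exponent flip: power_add)
      also have "\<dots> = - ((q ^ 2) ^ (2 * m + 3))"
        by (rule power_minus_odd) simp
      finally show ?thesis
        by (simp flip: power_mult)
    qed
    have four: "(4 :: complex) ^ Suc m * 4 ^ Suc (Suc m) = 4 ^ (2 * m + 3)"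
      by (simp only: exponent flip: power_add)
    have "Q (Suc m) * Q (Suc (Suc m)) =
        ((- (q ^ 2)) ^ Suc m * (- (q ^ 2)) ^ Suc (Suc m)) * (P ^ 2 * Z (Suc m)) / (4 ^ Suc m * 4 ^ Suc (Suc m))"
      unfolding Q prod.lessThan_Suc[of Z "Suc m"] P_def[symmetric] times_divide_times_eq
      by (simp only: mult_ac power2_eq_square)
    note QQ = this[unfolded qq four]
    have "q ^ (8 * m + 10) = q ^ (4 * m + 6) * (q ^ (2 * Suc m) * q ^ (2 * Suc m))"
    proof -
      have "8 * m + 10 = (4 * m + 6) + (2 * Suc m + 2 * Suc m)"
        by simp
      then show ?thesis
        by (simp only: power_add)
    qed
    moreover have "(fact (Suc m) :: complex) ^ 4 = fact (Suc m) ^ 2 * fact (Suc m) ^ 2"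
      by (simp flip: power_add)
    moreover have "(Q (Suc m) * q ^ (2 * Suc m) * fact (Suc m) ^ 2) * (- Q (Suc (Suc m)) * q ^ (2 * Suc m) * fact (Suc m) ^ 2) =
       - (Q (Suc m) * Q (Suc (Suc m))) * (q ^ (2 * Suc m) * q ^ (2 * Suc m)) * (fact (Suc m) ^ 2 * fact (Suc m) ^ 2)"
      by (simp only: mult_ac mult_minus_left mult_minus_right)
    ultimately show ?thesis
      unfolding QQ by simp
  qed
  finally have *: "(\<Prod>I\<le>2 * Suc m + 1. ?F I) =
      ((1 / 2 * q ^ (2 * m + 1)) ^ (2 * m + 2) * R) *
      (q ^ (8 * m + 10) / 4 ^ (2 * m + 3) * (fact (Suc m) ^ 4 * (P ^ 2 * Z (Suc m))))"
    unfolding Suc.IH R_def Z_def .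
  have "(\<Prod>l=0..m. fact l ^ 4 / 16 ^ l * Z l ^ (2 * (Suc m - l) + 1)) =
      (\<Prod>l=0..m. (fact l ^ 4 / 16 ^ l * Z l ^ (2 * (m - l) + 1)) * Z l ^ 2)"
  proof (rule prod.cong)
    fix l assume "l \<in> {0..m}"
    then have "2 * (Suc m - l) + 1 = (2 * (m - l) + 1) + 2" by auto
    then show "fact l ^ 4 / 16 ^ l * Z l ^ (2 * (Suc m - l) + 1) =
        (fact l ^ 4 / 16 ^ l * Z l ^ (2 * (m - l) + 1)) * Z l ^ 2"
      by (simp only: power_add mult.assoc)
  qed simp
  also have "\<dots> = R * P ^ 2"
    by (simp only: prod.distrib R_def P_def prod_power_distrib atLeast0AtMost lessThan_Suc_atMost)
  finally have R: "(\<Prod>l=0..Suc m. fact l ^ 4 / 16 ^ l * Z l ^ (2 * (Suc m - l) + 1)) =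
      R * P ^ 2 * (fact (Suc m) ^ 4 / 16 ^ Suc m * Z (Suc m))"
    by (simp del: fact_Suc power_Suc)
  have e: "(1 / 2 * q ^ (2 * Suc m + 1)) ^ (2 * Suc m + 2) =
      (1 / 2 * q ^ (2 * m + 1)) ^ (2 * m + 2) * (q ^ (8 * m + 10) / 4)"
  proof -
    have "(2 * Suc m + 1) * (2 * Suc m + 2) = (2 * m + 1) * (2 * m + 2) + (8 * m + 10)"
      by (simp add: algebra_simps)
    then have "(q ^ (2 * Suc m + 1)) ^ (2 * Suc m + 2) = (q ^ (2 * m + 1)) ^ (2 * m + 2) * q ^ (8 * m + 10)"
      by (metis power_mult power_add)
    moreover have "(1 / 2 :: complex) ^ (2 * Suc m + 2) = (1 / 2) ^ (2 * m + 2) / 4"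
      by simp
    ultimately show ?thesis
      unfolding power_mult_distrib by (simp only: times_divide_eq_left times_divide_eq_right mult_ac)
  qed
  have "(4 :: complex) ^ (2 * m + 3) = 4 * 16 ^ Suc m"
  proof -
    have "(16 :: complex) ^ Suc m = 4 ^ (2 * Suc m)"
      unfolding power_mult by simp
    moreover have "2 * m + 3 = 1 + 2 * Suc m"
      by simp
    ultimately show ?thesis
      by (simp only: power_add power_one_right)
  qed
  then show ?case
    unfolding * Z_def[symmetric] R e by (simp del: fact_Suc power_Suc)
qed

section \<open>Assembly of the four determinant formulas\<close>

theorem corollary4p4:
  fixes q m :: nat and chi1 chi2 :: "nat \<Rightarrow> complex"
    and b1 b2 :: "nat \<Rightarrow> complex poly" and qt :: complex
  assumes "(q = 4 \<and> chi1 = chi_8_1 \<and> chi2 = chi_8_2) \<or>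
           (q = 6 \<and> chi1 = chi_12_1 \<and> chi2 = chi_12_2)"
  defines "qt \<equiv> (of_nat q - 2) / of_nat q"
    and "b1 \<equiv> (\<lambda>k. smult (1 / of_nat (k + 1)) (gen_bernpoly (2 * q) chi1 (k + 1)))"
    and "b2 \<equiv> (\<lambda>k. smult (1 / of_nat (k + 1)) (gen_bernpoly (2 * q) chi2 (k + 1)))"
  shows
    "let h1 = (-1) ^ (m + 1) * ((of_nat q - 2) / 2 * of_nat q ^ (2 * m)) ^ (2 * m + 2) *
           (\<Prod>l = 1..m. (of_nat l ^ 2 / 4 * (qt ^ 2 - (2 * of_nat l) ^ 2)) ^ (2 * (m + 1 - l)));
         h2 = (-1) ^ (m + 1) * (of_nat q ^ (2 * m * (2 * m + 1)) / (fact m) ^ 2) *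
           (\<Prod>l = 1..m. (of_nat l ^ 2 / 4 * (qt ^ 2 - (2 * of_nat l - 1) ^ 2)) ^ (2 * (m + 1 - l)));
         h3 = (1 / 2 * of_nat q ^ (2 * m + 1)) ^ (2 * m + 2) *
           (\<Prod>l = 0..m. (fact l) ^ 4 / 16 ^ l *
              (qt ^ 2 - (2 * of_nat l + 1) ^ 2) ^ (2 * (m - l) + 1))
     in
       \<comment> \<open>x a variable: identities in the polynomial ring\<close>
       (hankel_det (2 * m) b1 = 0 \<and>
        hankel_det (2 * m + 1) b1 = [:h1:] \<and>
        hankel_det (2 * m) b2 = [:h2:] \<and>
        hankel_det (2 * m + 1) b2 = [:h3:]) \<and>
       \<comment> \<open>x a complex number\<close>
       (\<forall>x :: complex.
        hankel_det (2 * m) (\<lambda>k. poly (b1 k) x) = 0 \<and>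
        hankel_det (2 * m + 1) (\<lambda>k. poly (b1 k) x) = h1 \<and>
        hankel_det (2 * m) (\<lambda>k. poly (b2 k) x) = h2 \<and>
        hankel_det (2 * m + 1) (\<lambda>k. poly (b2 k) x) = h3)"
proof -
  have q: "q > 0" "of_nat q \<noteq> (0 :: complex)"
    using assms(1) by auto
  let ?E = "fps_exp 1 :: complex fps"
  have E: "?E ^ (2 * q) - 1 = (?E ^ q - 1) * (?E ^ q + 1)"
    unfolding mult_2 power_add by (simp add: algebra_simps)
  have E0: "?E ^ q - 1 \<noteq> 0"
    using q by (simp add: fps_exp_power_mult)
  obtain G1 where G1: "gen_bernoulli_egf (2 * q) chi1 = fps_X * G1"
    and "G1 * (?E ^ (2 * q) - 1) = (\<Sum>a=1..2 * q. fps_const (chi1 a) * ?E ^ a)"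
    using gen_bernoulli_egf_factor[of "2 * q" chi1] character_sums(1)[OF assms(1)] q by auto
  then have "(?E ^ q - 1) * (G1 * (?E ^ q + 1)) = (?E ^ q - 1) * (?E ^ (q - 1) + fps_const (-1) * ?E)"
    unfolding E character_sums(3)[OF assms(1)] by (simp add: mult_ac flip: fps_const_neg)
  then have "G1 * (?E ^ q + 1) = ?E ^ (q - 1) + fps_const (-1) * ?E"
    using E0 by simp
  then interpret c1: sech_type_egf G1 "of_nat q" "of_nat q / 2 - 1" "-1"
    by (intro sech_type_egf_of_half_sum q) auto
  obtain G2 where G2: "gen_bernoulli_egf (2 * q) chi2 = fps_X * G2"
    and "G2 * (?E ^ (2 * q) - 1) = (\<Sum>a=1..2 * q. fps_const (chi2 a) * ?E ^ a)"
    using gen_bernoulli_egf_factor[of "2 * q" chi2] character_sums(2)[OF assms(1)] q by auto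
  \<comment> \<open>The second character sum carries a minus sign, so -G2 satisfies the equation
    with \<epsilon> = 1. Undoing this costs (-1)^(n + 1): -1 for n = 2m and 1 for n = 2m +
    1.\<close>
  then have "(?E ^ q - 1) * (- G2 * (?E ^ q + 1)) = (?E ^ q - 1) * (?E ^ (q - 1) + fps_const 1 * ?E)"
    unfolding E character_sums(4)[OF assms(1)] by (simp add: mult_ac)
  then have "- G2 * (?E ^ q + 1) = ?E ^ (q - 1) + fps_const 1 * ?E"
    using E0 by (simp only: mult_cancel_left) simp
  then interpret c2: sech_type_egf "- G2" "of_nat q" "of_nat q / 2 - 1" 1
    by (intro sech_type_egf_of_half_sum q) auto
  have hankel_b1: "hankel_det n (\<lambda>k. poly (b1 k) x) = hankel_det n (\<lambda>k. fact k * fps_nth G1 k)" for n x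
    unfolding b1_def poly_gen_bernpoly_moment[OF G1] by (rule hankel_det_exp_mult)
  have hankel_b2: "hankel_det n (\<lambda>k. poly (b2 k) x) = (-1) ^ (n + 1) * hankel_det n (\<lambda>k. fact k * fps_nth (- G2) k)" for n x
    unfolding b2_def poly_gen_bernpoly_moment[OF G2] hankel_det_exp_mult
    using hankel_det_uminus[of n "\<lambda>k. fact k * fps_nth (- G2) k"] by simp
  have ab: "c1.a = of_nat q - 1" "c1.b = 1" "c2.a = of_nat q - 1" "c2.b = 1"
    by (simp_all add: c1.a_def c1.b_def c2.a_def c2.b_def)
  note h1 = hankel_b1[of "2 * m + 1", unfolded c1.hankel_det_odd_egf[OF refl] ab prod_h1[OF q(2)], folded qt_def]
  have h0: "hankel_det (2 * m) (\<lambda>k. poly (b1 k) x) = 0" for x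
    unfolding hankel_b1 by (rule c1.hankel_det_odd_egf_eq_0) simp
  note h2 = hankel_b2[of "2 * m", unfolded c2.hankel_det_even_egf[OF refl] ab prod_h2[OF q(2)], folded qt_def]
  note h3 = hankel_b2[of "2 * m + 1", unfolded c2.hankel_det_even_egf[OF refl] ab prod_h3[OF q(2)], folded qt_def]
  show ?thesis
    unfolding Let_def
    using hankel_det_poly_constI[of "2 * m" b1, OF h0] hankel_det_poly_constI[of "2 * m + 1" b1, OF h1]
      hankel_det_poly_constI[of "2 * m" b2, OF h2] hankel_det_poly_constI[of "2 * m + 1" b2, OF h3] h0 h1 h2 h3
    by (simp add: mult.assoc)
qed

end
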